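(* Let $\mathbf{A}\in\mathbb{F}^{m\times n}$ and let $\mathbf{A}_{\mathrm{CUR}}$ be a (fixed) rank-$r$ CUR approximation of $\mathbf{A}$ with selected row and column index sets $\mathcal{I}$ and $\mathcal{J}$, where $r<n$. Let $\mathcal{J}_q\subset\{1,\dots,n\}\setminus\mathcal{J}$ be a random set of $q$ extra column indices, and define $$\mathcal{S}:=\{\ell\in\{1,\dots,n\}:\ \|(\mathbf{A}-\mathbf{A}_{\mathrm{CUR}})\mathbf{e}_\ell\|_2>0\}.$$ Assume that $p_\ell:=\mathbb{P}(\ell\in\mathcal{J}_q)>0$ for every $\ell\in\mathcal{S}$, and set $w_\ell=p_\ell^{-1/2}$. Let $\mathbf{S}_q=\mathbf{W}\,\mathbf{I}(:,\mathcal{J}_q)$, where $\mathbf{W}$ is the $n\times n$ diagonal matrix with diagonal entries $w_\ell$. Then $$\mathbb{E}\big[\|(\mathbf{A}-\mathbf{A}_{\mathrm{CUR}})\mathbf{S}_q\|_F^2\big]=\|\mathbf{A}-\mathbf{A}_{\mathrm{CUR}}\|_F^2 .$$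
   Context: $\mathbb{F}$ is $\mathbb{R}$ or $\mathbb{C}$; $\|\cdot\|_F$ is the Frobenius norm and $\|\cdot\|_2$ the Euclidean norm; $\mathbf{e}_\ell$ is the $\ell$-th canonical basis vector of $\mathbb{F}^n$; $\mathbf{I}$ is the $n\times n$ identity matrix and $\mathbf{I}(:,\mathcal{J}_q)$ is its submatrix formed by the columns indexed by $\mathcal{J}_q$. CUR approximation: given a set $\mathcal{I}$ of $s$ row indices and a set $\mathcal{J}$ of $r$ column indices of $\mathbf{A}$ (indexing linearly independent rows, respectively columns), $\mathbf{A}_{\mathrm{CUR}}=\mathbf{A}(:,\mathcal{J})\,\mathbf{A}(\mathcal{I},\mathcal{J})^{\dagger}\,\mathbf{A}(\mathcal{I},:)$, where $\dagger$ denotes the Moore-Penrose pseudoinverse. All expectations and probabilities are conditional on the choice of $\mathbf{A}_{\mathrm{CUR}}$: the matrices $\mathbf{A}$, $\mathbf{A}_{\mathrm{CUR}}$ and the sets $\mathcal{I},\mathcal{J}$ are fixed, and the only randomness is in the set $\mathcal{J}_q$, which has $q$ elements and an arbitrary distribution subject to the stated condition. For $\ell\notin\mathcal{S}$ with $p_\ell=0$ the value $w_\ell$ is an arbitrary finite number; it plays no role since the corresponding residual column is zero. *)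

theory Defs
  imports
    "HOL-Probability.Probability"
    "Jordan_Normal_Form.DL_Rank"
    "Jordan_Normal_Form.DL_Submatrix"
    "Jordan_Normal_Form.Schur_Decomposition"
begin

text \<open>
  The two instances below are the intended ones. The axiom ties the abstract conjugation to the
  norm, which determines it uniquely; by the Gelfand--Mazur theorem every model of the class is
  isomorphic to the reals or to the complex numbers.
\<close>

class real_or_complex = real_normed_field + conjugatable_field +
  assumes mult_conjugate: "x * conjugate x = (norm x)\<^sup>2 *\<^sub>R 1"

instance real :: real_or_complex
proof
  fix x :: real
  show "x * conjugate x = (norm x)\<^sup>2 *\<^sub>R 1"
    unfolding conjugate_real_def real_norm_def power2_abs real_scaleR_def mult_1_right
    by (rule power2_eq_square [symmetric])
qed

instance complex :: real_or_complex
proof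
  fix x :: complex
  show "x * conjugate x = (norm x)\<^sup>2 *\<^sub>R 1"
    unfolding conjugate_complex_def scaleR_conv_of_real mult_1_right
    by (rule complex_norm_square [symmetric])
qed

definition eucl_norm :: "'a :: real_normed_field Matrix.vec \<Rightarrow> real" where
  "eucl_norm v = sqrt (\<Sum>i<dim_vec v. (norm (vec_index v i))\<^sup>2)"

definition frob_norm :: "'a :: real_normed_field mat \<Rightarrow> real" where
  "frob_norm A = sqrt (\<Sum>i<dim_row A. \<Sum>j<dim_col A. (norm (A $$ (i, j)))\<^sup>2)"

definition is_pinv :: "'a :: conjugatable_field mat \<Rightarrow> 'a mat \<Rightarrow> bool" where
  "is_pinv A X \<longleftrightarrow> X \<in> carrier_mat (dim_col A) (dim_row A)
     \<and> A * X * A = A \<and> X * A * X = X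
     \<and> mat_adjoint (A * X) = A * X \<and> mat_adjoint (X * A) = X * A"

text \<open>The Penrose equations have exactly one solution over the reals and the complex numbers.\<close>

definition pinv :: "'a :: real_or_complex mat \<Rightarrow> 'a mat" where
  "pinv A = (THE X. is_pinv A X)"

text \<open>
  Distinctness is required separately because linear (in)dependence is a property of the set of
  columns, which does not see repetitions.
\<close>

definition lin_indpt_cols :: "'a :: field mat \<Rightarrow> bool" where
  "lin_indpt_cols B \<longleftrightarrow> distinct (cols B)
     \<and> \<not> LinearCombinations.module.lin_dep class_ring (module_vec TYPE('a) (dim_row B)) (set (cols B))"

text \<open>
  Rows and columns are indexed from \<open>0\<close>. The index set \<open>UNIV\<close> selects all rows (columns), so
  that \<open>submatrix A UNIV J\<close> is \<open>A(:,J)\<close> and \<open>submatrix A I UNIV\<close> is \<open>A(I,:)\<close>; the selected rows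
  and columns are kept in increasing order.
\<close>

definition cur_approx :: "'a :: real_or_complex mat \<Rightarrow> nat set \<Rightarrow> nat set \<Rightarrow> 'a mat" where
  "cur_approx A I J = submatrix A UNIV J * pinv (submatrix A I J) * submatrix A I UNIV"

definition sampling_mat :: "nat \<Rightarrow> (nat \<Rightarrow> 'a :: field) \<Rightarrow> nat set \<Rightarrow> 'a mat" where
  "sampling_mat n w K = mat_diag n w * submatrix (1\<^sub>m n) UNIV K"

end

theory Submission
  imports Defs
begin

text \<open>Write R for the residual \<open>A - cur_approx A I J\<close>. The squared Frobenius norm
  is the sum of the squared column norms, and right multiplication by the sampling matrix keeps the
  columns of R indexed by \<open>Jq\<close> and scales column l by \<open>w l\<close>. Hence the
  random quantity is the sum over l in \<open>Jq\<close> of |w l|^2 |R e_l|^2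
  (\<open>power2_frob_norm_mult_sampling_mat\<close>). Linearity of expectation turns it into the
  sum over all l < n of p l |w l|^2 |R e_l|^2 (\<open>expectation_sum_random_subset\<close>), which
  sees the distribution of \<open>Jq\<close> only through the inclusion probabilities. Each term
  equals |R e_l|^2: either the column vanishes, or l lies in \<open>S\<close> and the weight is
  chosen so that p l |w l|^2 = 1.\<close>

lemma power2_eucl_norm: "(eucl_norm v)\<^sup>2 = (\<Sum>i<dim_vec v. (norm (vec_index v i))\<^sup>2)"
  unfolding eucl_norm_def by (intro real_sqrt_pow2 sum_nonneg) simp

lemma eucl_norm_nonneg: "eucl_norm v \<ge> 0"
  unfolding eucl_norm_def by (intro real_sqrt_ge_zero sum_nonneg) simp

lemma power2_frob_norm:
  "(frob_norm B)\<^sup>2 = (\<Sum>i<dim_row B. \<Sum>j<dim_col B. (norm (B $$ (i, j)))\<^sup>2)"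
  unfolding frob_norm_def by (intro real_sqrt_pow2 sum_nonneg) simp

lemma power2_frob_norm_eq_sum_cols:
  "(frob_norm B)\<^sup>2 = (\<Sum>j<dim_col B. (eucl_norm (col B j))\<^sup>2)"
  unfolding power2_frob_norm power2_eucl_norm by (subst sum.swap) simp

lemma mult_unit_vec_eq_col:
  fixes B :: "'a :: semiring_1 mat"
  assumes "B \<in> carrier_mat m n" "l < n"
  shows "B *\<^sub>v unit_vec n l = col B l"
  using assms by (intro eq_vecI) auto

text \<open>\<open>pick K\<close> is strictly increasing below \<open>card K\<close>, hence
  injective there; its image lies in \<open>K\<close> and has the same finite cardinality. This
  converts sums over column positions into sums over column indices.\<close>

lemma bij_betw_pick:
  assumes "finite K"
  shows "bij_betw (pick K) {..<card K} K"
proof -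
  have inj: "inj_on (pick K) {..<card K}"
    by (intro linorder_inj_onI) (use pick_mono_le in fastforce)+
  moreover have "pick K ` {..<card K} \<subseteq> K"
    using pick_in_set_le by auto
  ultimately show ?thesis
    using assms by (simp add: bij_betw_def card_image card_subset_eq)
qed

text \<open>The shape of a product is read off its outer factors, so the definite description behind
  \<open>pinv\<close> stays folded.\<close>

lemma cur_approx_carrier:
  assumes "A \<in> carrier_mat m n"
  shows "cur_approx A I J \<in> carrier_mat m n"
  using assms unfolding cur_approx_def by (auto simp: dim_submatrix)

lemma sampling_mat_eq_mat:
  assumes "K \<subseteq> {..<n}"
  shows "sampling_mat n w K = mat n (card K) (\<lambda>(i, j). if i = pick K j then w i else 0)"
proof -
  \<comment> \<open>\<open>submatrix\<close> counts only the selected indices below the dimension;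
    the inclusion of \<open>K\<close> makes that count \<open>card K\<close>.\<close>
  have K: "{j. j < n \<and> j \<in> K} = K"
    using assms by auto
  have "pick K j < n" if "j < card K" for j
    using pick_in_set_le[OF that] assms by auto
  then have sel: "submatrix (1\<^sub>m n) UNIV K = mat n (card K) (\<lambda>(i, j). if i = pick K j then 1 else 0)"
    unfolding submatrix_def by (intro eq_matI) (auto simp: K pick_UNIV)
  show ?thesis
    unfolding sampling_mat_def sel by (auto simp: mat_diag_mult_left[of _ n "card K"] intro!: eq_matI)
qed

lemma mult_sampling_mat:
  assumes B: "B \<in> carrier_mat m n" and K: "K \<subseteq> {..<n}"
  shows "B * sampling_mat n w K = mat m (card K) (\<lambda>(i, j). B $$ (i, pick K j) * w (pick K j))"
proof (rule eq_matI)
  fix i j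
  assume "i < dim_row (mat m (card K) (\<lambda>(i, j). B $$ (i, pick K j) * w (pick K j)))"
    and "j < dim_col (mat m (card K) (\<lambda>(i, j). B $$ (i, pick K j) * w (pick K j)))"
  then have ij: "i < m" "j < card K"
    by auto
  \<comment> \<open>This puts \<open>pick K j\<close> inside the range of the scalar product, where
    it gives the only surviving term.\<close>
  have "pick K j < n"
    using pick_in_set_le[OF ij(2)] K by auto
  then show "(B * sampling_mat n w K) $$ (i, j)
      = mat m (card K) (\<lambda>(i, j). B $$ (i, pick K j) * w (pick K j)) $$ (i, j)"
    using B ij by (simp add: sampling_mat_eq_mat[OF K] scalar_prod_def if_distrib cong: if_cong)
qed (use B in \<open>auto simp: sampling_mat_eq_mat[OF K]\<close>)

text \<open>Column j of the product is column \<open>pick K j\<close> of \<open>B\<close> times a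
  scalar, whose norm factors out; the sum over j is then reindexed along
  \<open>pick K\<close>.\<close>

lemma power2_frob_norm_mult_sampling_mat:
  fixes B :: "'a :: real_normed_field mat"
  assumes B: "B \<in> carrier_mat m n" and K: "K \<subseteq> {..<n}"
  shows "(frob_norm (B * sampling_mat n w K))\<^sup>2
       = (\<Sum>l\<in>K. (norm (w l))\<^sup>2 * (eucl_norm (col B l))\<^sup>2)"
proof -
  have pick: "pick K j < n" if "j < card K" for j
    using pick_in_set_le[OF that] K by auto
  have fin: "finite K"
    using K finite_subset by blast
  have "(frob_norm (B * sampling_mat n w K))\<^sup>2
      = (\<Sum>j<card K. (norm (w (pick K j)))\<^sup>2 * (eucl_norm (col B (pick K j)))\<^sup>2)"
    unfolding power2_frob_norm_eq_sum_cols power2_eucl_norm mult_sampling_mat[OF B K] sum_distrib_left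
    using B pick by (auto simp: norm_mult power_mult_distrib mult.commute intro!: sum.cong)
  also have "\<dots> = (\<Sum>l\<in>K. (norm (w l))\<^sup>2 * (eucl_norm (col B l))\<^sup>2)"
    by (rule sum.reindex_bij_betw[OF bij_betw_pick[OF fin]])
  finally show ?thesis .
qed

text \<open>Indicators move the randomness from the index set into the summands. The sum then runs
  over the fixed finite set \<open>X\<close>, and each indicator integrates to the probability of
  its event.\<close>

lemma (in prob_space) expectation_sum_random_subset:
  fixes c :: "'b \<Rightarrow> real"
  assumes fin: "finite X"
    and meas: "\<And>l. l \<in> X \<Longrightarrow> {\<omega> \<in> space M. l \<in> K \<omega>} \<in> events"
    and sub: "\<And>\<omega>. \<omega> \<in> space M \<Longrightarrow> K \<omega> \<subseteq> X"
  shows "expectation (\<lambda>\<omega>. \<Sum>l\<in>K \<omega>. c l) = (\<Sum>l\<in>X. prob {\<omega> \<in> space M. l \<in> K \<omega>} * c l)"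
proof -
  have "expectation (\<lambda>\<omega>. \<Sum>l\<in>K \<omega>. c l)
      = expectation (\<lambda>\<omega>. \<Sum>l\<in>X. indicator {\<omega> \<in> space M. l \<in> K \<omega>} \<omega> * c l)"
  proof (intro Bochner_Integration.integral_cong refl)
    fix \<omega> assume \<omega>: "\<omega> \<in> space M"
    show "(\<Sum>l\<in>K \<omega>. c l) = (\<Sum>l\<in>X. indicator {\<omega> \<in> space M. l \<in> K \<omega>} \<omega> * c l)"
      using sub[OF \<omega>] \<omega> by (intro sum.mono_neutral_cong_left fin) (auto simp: indicator_def)
  qed
  also have "\<dots> = (\<Sum>l\<in>X. prob {\<omega> \<in> space M. l \<in> K \<omega>} * c l)"
    using meas by (subst Bochner_Integration.integral_sum) (auto simp: less_top[symmetric])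
  finally show ?thesis .
qed

theorem theorem1:
  fixes A :: "'a :: real_or_complex mat"
    and m n r q :: nat
    and I J S :: "nat set"
    and M :: "'w measure"
    and Jq :: "'w \<Rightarrow> nat set"
    and p :: "nat \<Rightarrow> real"
    and w :: "nat \<Rightarrow> 'a"
  defines "S \<equiv> {l \<in> {..<n}. eucl_norm ((A - cur_approx A I J) *\<^sub>v unit_vec n l) > 0}"
    and "p \<equiv> \<lambda>l. measure M {\<omega> \<in> space M. l \<in> Jq \<omega>}"
  assumes "A \<in> carrier_mat m n"
    and "I \<subseteq> {..<m}" and "lin_indpt_cols (transpose_mat (submatrix A I UNIV))"
    and "J \<subseteq> {..<n}" and "lin_indpt_cols (submatrix A UNIV J)"
    and "card J = r" and "vec_space.rank m (cur_approx A I J) = r" and "r < n"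
    and "prob_space M"
    and "Jq \<in> measurable M (count_space {K. K \<subseteq> {..<n} - J \<and> card K = q})"
    and "\<And>l. l \<in> S \<Longrightarrow> p l > 0"
    and "\<And>l. l < n \<Longrightarrow> p l > 0 \<Longrightarrow> w l = of_real (p l powr (- 1 / 2))"
  shows "prob_space.expectation M
           (\<lambda>\<omega>. (frob_norm ((A - cur_approx A I J) * sampling_mat n w (Jq \<omega>)))\<^sup>2)
         = (frob_norm (A - cur_approx A I J))\<^sup>2"
proof -
  interpret prob_space M by fact
  define R where "R = A - cur_approx A I J"
  have R: "R \<in> carrier_mat m n"
    unfolding R_def by (intro minus_carrier_mat cur_approx_carrier) fact
  have sub: "Jq \<omega> \<subseteq> {..<n}" if "\<omega> \<in> space M" for \<omega>
    using measurable_space[OF \<open>Jq \<in> measurable M _\<close> that] by auto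
  have meas: "{\<omega> \<in> space M. l \<in> Jq \<omega>} \<in> events" for l
  proof -
    \<comment> \<open>Adding the admissibility conditions exhibits the event as the preimage of a
      subset of the underlying discrete space, where all subsets are measurable.\<close>
    have "{\<omega> \<in> space M. l \<in> Jq \<omega>}
        = Jq -` {K. l \<in> K \<and> K \<subseteq> {..<n} - J \<and> card K = q} \<inter> space M"
      using measurable_space[OF \<open>Jq \<in> measurable M _\<close>] by auto
    also have "\<dots> \<in> events"
      by (rule measurable_sets[OF \<open>Jq \<in> measurable M _\<close>]) auto
    finally show ?thesis .
  qed
  have weight: "p l * ((norm (w l))\<^sup>2 * (eucl_norm (col R l))\<^sup>2) = (eucl_norm (col R l))\<^sup>2"
    if "l < n" for l
  \<comment> \<open>For a zero column both sides are 0 whatever \<open>w l\<close> is. Otherwise l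
    is in \<open>S\<close>, so \<open>p l\<close> is positive and \<open>w l\<close> has its
    prescribed value.\<close>
  proof (cases "eucl_norm (col R l) = 0")
    case False
    then have "l \<in> S"
      using that eucl_norm_nonneg[of "col R l"]
      by (simp add: S_def R_def[symmetric] mult_unit_vec_eq_col[OF R])
    then have p: "p l > 0"
      by fact
    then have "w l = of_real (p l powr (- 1 / 2))"
      using that assms(14) by blast
    \<comment> \<open>The two exponents -1/2 add up to -1, which cancels the factor
      \<open>p l\<close>.\<close>
    then have "(norm (w l))\<^sup>2 = p l powr (-1)"
      by (simp add: power2_eq_square powr_add[symmetric])
    then show ?thesis
      using p by (simp add: powr_minus)
  qed simp
  have "expectation (\<lambda>\<omega>. (frob_norm (R * sampling_mat n w (Jq \<omega>)))\<^sup>2)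
      = expectation (\<lambda>\<omega>. \<Sum>l\<in>Jq \<omega>. (norm (w l))\<^sup>2 * (eucl_norm (col R l))\<^sup>2)"
    by (intro Bochner_Integration.integral_cong refl power2_frob_norm_mult_sampling_mat[OF R] sub)
  also have "\<dots> = (\<Sum>l<n. p l * ((norm (w l))\<^sup>2 * (eucl_norm (col R l))\<^sup>2))"
    unfolding p_def using meas sub by (intro expectation_sum_random_subset) auto
  also have "\<dots> = (frob_norm R)\<^sup>2"
    using R by (simp add: power2_frob_norm_eq_sum_cols weight del: mult_eq_0_iff cong: sum.cong_simp)
  finally show ?thesis
    unfolding R_def .
qed

end
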